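(* For $\epsilon,\bar\epsilon\in[0,\infty)$, the algebras $(U_\epsilon,\circ)$ and $(U_{\bar\epsilon},\circ)$ are not isomorphic if $\epsilon\ne\bar\epsilon$.
   Context: For $\epsilon\in[0,\infty)$, $(U_\epsilon,\circ)$ is the commutative $\mathbb{R}$-algebra with underlying three-dimensional real vector space having basis $\{f_0,f_1,f_2\}$ and multiplication given by $$f_0\circ f_0=f_0,\quad f_0\circ f_1=(\tfrac12-\epsilon)f_1,\quad f_0\circ f_2=(\tfrac12+\epsilon)f_2,$$ $$f_1\circ f_1=(\tfrac12-\epsilon)f_0,\quad f_1\circ f_2=0,\quad f_2\circ f_2=(\tfrac12+\epsilon)f_0.$$ *)

theory Defs
  imports "HOL-Analysis.Analysis"
begin

(* The underlying vector space of U_eps is real ^ 3. The index type 3 counts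
   from 1 in "vector" and in "axis" below, so f_k sits at index k + 1. *)

definition f0 :: "real ^ 3" where "f0 = axis 1 1"
definition f1 :: "real ^ 3" where "f1 = axis 2 1"
definition f2 :: "real ^ 3" where "f2 = axis 3 1"

definition U_table :: "real \<Rightarrow> ((real ^ 3) ^ 3) ^ 3" where
  "U_table \<epsilon> = vector
     [vector [f0,                  (1/2 - \<epsilon>) *\<^sub>R f1,  (1/2 + \<epsilon>) *\<^sub>R f2],
      vector [(1/2 - \<epsilon>) *\<^sub>R f1,  (1/2 - \<epsilon>) *\<^sub>R f0,  0],
      vector [(1/2 + \<epsilon>) *\<^sub>R f2,  0,                  (1/2 + \<epsilon>) *\<^sub>R f0]]"

definition U_mult :: "real \<Rightarrow> real ^ 3 \<Rightarrow> real ^ 3 \<Rightarrow> real ^ 3" where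
  "U_mult \<epsilon> x y = (\<Sum>i\<in>UNIV. \<Sum>j\<in>UNIV. (x $ i * y $ j) *\<^sub>R (U_table \<epsilon> $ i $ j))"

(* Algebras are real vector spaces with a bilinear product; neither
   associativity nor a unit is assumed, so an isomorphism is only required to
   be linear, bijective and multiplicative. *)

definition algebra_isomorphic ::
    "('a::real_vector \<Rightarrow> 'a \<Rightarrow> 'a) \<Rightarrow> ('b::real_vector \<Rightarrow> 'b \<Rightarrow> 'b) \<Rightarrow> bool" where
  "algebra_isomorphic mulA mulB \<longleftrightarrow>
     (\<exists>\<phi>. linear \<phi> \<and> bij \<phi> \<and> (\<forall>x y. \<phi> (mulA x y) = mulB (\<phi> x) (\<phi> y)))"

lemma U_basis: "independent {f0, f1, f2}" "span {f0, f1, f2} = UNIV" "card {f0, f1, f2} = 3"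
proof -
  have eq: "{f0, f1, f2} = (Basis :: (real ^ 3) set)"
    unfolding f0_def f1_def f2_def Basis_vec_def by (auto simp: UNIV_3)
  show "independent {f0, f1, f2}" "span {f0, f1, f2} = UNIV" "card {f0, f1, f2} = 3"
    unfolding eq by (simp_all add: independent_Basis)
qed

lemma U_mult_components:
  "U_mult \<epsilon> x y = vector
     [x$1 * y$1 + (1/2 - \<epsilon>) * (x$2 * y$2) + (1/2 + \<epsilon>) * (x$3 * y$3),
      (1/2 - \<epsilon>) * (x$1 * y$2 + x$2 * y$1),
      (1/2 + \<epsilon>) * (x$1 * y$3 + x$3 * y$1)]"
  by (simp add: vec_eq_iff forall_3 U_mult_def U_table_def sum_3 f0_def f1_def f2_def axis_def
      algebra_simps)

lemma U_mult_basis: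
  "U_mult \<epsilon> f0 f0 = f0"
  "U_mult \<epsilon> f0 f1 = (1/2 - \<epsilon>) *\<^sub>R f1"
  "U_mult \<epsilon> f0 f2 = (1/2 + \<epsilon>) *\<^sub>R f2"
  "U_mult \<epsilon> f1 f1 = (1/2 - \<epsilon>) *\<^sub>R f0"
  "U_mult \<epsilon> f1 f2 = 0"
  "U_mult \<epsilon> f2 f2 = (1/2 + \<epsilon>) *\<^sub>R f0"
  by (simp_all add: vec_eq_iff forall_3 U_mult_components f0_def f1_def f2_def axis_def)

lemma U_mult_commute: "U_mult \<epsilon> x y = U_mult \<epsilon> y x"
  by (simp add: U_mult_components algebra_simps add_divide_distrib)

lemma bilinear_U_mult: "bilinear (U_mult \<epsilon>)"
  unfolding bilinear_def
  by (auto intro!: linearI simp: vec_eq_iff forall_3 U_mult_components algebra_simps add_divide_distrib)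

end

theory Submission
  imports Defs
begin

text \<open>
  The parameter can be read off from the algebra because \<^term>\<open>f0\<close> is characterised
  intrinsically, as the only idempotent whose multiplication operator has trace \<open>2\<close>. Indeed the
  operator of multiplication by \<open>x\<close> has trace \<open>(1 + (1/2 - \<epsilon>) + (1/2 + \<epsilon>)) x\<^sub>0 = 2 x\<^sub>0\<close>, where
  \<open>x\<^sub>0\<close> is the coefficient of \<^term>\<open>f0\<close>; this does not depend on \<open>\<epsilon>\<close>. An isomorphism
  \<open>\<phi>\<close> conjugates multiplication by \<open>x\<close> into multiplication by \<open>\<phi> x\<close>, so it preserves that trace and
  hence \<open>x\<^sub>0\<close> (\<open>isomorphism_preserves_f0_coordinate\<close>). Since an idempotent with \<open>x\<^sub>0 = 1\<close>
  is \<^term>\<open>f0\<close> (\<open>idempotent_eq_f0\<close>), every isomorphism \<open>U\<^sub>\<epsilon> \<rightarrow> U\<^sub>\<epsilon>\<^sub>'\<close> fixes \<^term>\<open>f0\<close>.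
  It therefore carries eigenvectors of multiplication by \<^term>\<open>f0\<close> to eigenvectors with the same
  eigenvalue, so the spectra \<open>{1, 1/2 - \<epsilon>, 1/2 + \<epsilon>}\<close> and \<open>{1, 1/2 - \<epsilon>', 1/2 + \<epsilon>'}\<close> agree,
  and for nonnegative parameters this forces \<open>\<epsilon> = \<epsilon>'\<close>.
\<close>

lemma trace_matrix_conjugate:
  fixes \<phi> f g :: "real ^ 'n \<Rightarrow> real ^ 'n"
  assumes "linear \<phi>" "bij \<phi>" "linear f" "linear g"
    and intertwines: "\<And>x. \<phi> (f x) = g (\<phi> x)"
  shows "trace (matrix f) = trace (matrix g)"
proof -
  have lin_inv: "linear (inv \<phi>)"
    using assms(1,2) by (simp add: bij_is_inj bij_is_surj inj_linear_imp_inv_linear)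
  have f_eq: "f = inv \<phi> \<circ> (g \<circ> \<phi>)"
    using assms(2) by (auto simp: fun_eq_iff bij_is_inj simp flip: intertwines)
  have g_eq: "g = (g \<circ> \<phi>) \<circ> inv \<phi>"
    using assms(2) by (auto simp: fun_eq_iff bij_is_surj surj_f_inv_f)
  have lin: "linear (g \<circ> \<phi>)"
    using assms by (simp add: linear_compose)
  have "trace (matrix f) = trace (matrix (inv \<phi>) ** matrix (g \<circ> \<phi>))"
    by (subst f_eq, subst matrix_compose) (use lin lin_inv in auto)
  also have "\<dots> = trace (matrix (g \<circ> \<phi>) ** matrix (inv \<phi>))"
    by (rule trace_mul_sym)
  also have "\<dots> = trace (matrix g)"
    by (subst (2) g_eq, subst matrix_compose) (use lin lin_inv in auto)
  finally show ?thesis .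
qed

lemma trace_U_mult: "trace (matrix (U_mult \<epsilon> x)) = 2 * x $ 1"
  by (simp add: trace_def matrix_def sum_3 U_mult_components axis_def algebra_simps)

lemma isomorphism_preserves_f0_coordinate:
  assumes "linear \<phi>" "bij \<phi>" "\<And>x y. \<phi> (U_mult \<epsilon> x y) = U_mult \<epsilon>' (\<phi> x) (\<phi> y)"
  shows "\<phi> x $ 1 = x $ 1"
proof -
  have "linear (U_mult \<delta> y)" for \<delta> y
    using bilinear_U_mult by (simp add: bilinear_def)
  then have "trace (matrix (U_mult \<epsilon> x)) = trace (matrix (U_mult \<epsilon>' (\<phi> x)))"
    using assms by (intro trace_matrix_conjugate[of \<phi>])
  then show ?thesis
    by (simp add: trace_U_mult)
qed

text \<open>
  With \<open>x\<^sub>0 = 1\<close>, idempotency makes the other two coordinates eigencomponents of multiplication by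
  \<^term>\<open>f0\<close> for the eigenvalue \<open>1/2\<close>, so they vanish unless \<open>\<epsilon> = 0\<close>. In that exceptional case
  the first coordinate of the equation says that the sum of their squares is zero.
\<close>

lemma idempotent_eq_f0:
  assumes idem: "U_mult \<epsilon> x x = x" and one: "x $ 1 = 1"
  shows "x = f0"
proof -
  have eqs: "(1/2 - \<epsilon>) * (x$2 * x$2) + (1/2 + \<epsilon>) * (x$3 * x$3) = 0"
      "\<epsilon> * x$2 = 0" "\<epsilon> * x$3 = 0"
    using idem one by (simp_all add: vec_eq_iff forall_3 U_mult_components algebra_simps)
  have "x$2 = 0 \<and> x$3 = 0"
  proof (cases "\<epsilon> = 0")
    case True
    with eqs(1) have "x$2 * x$2 + x$3 * x$3 = 0" by (simp add: field_simps)
    then show ?thesis by (simp add: sum_squares_eq_zero_iff)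
  qed (use eqs in auto)
  with one show ?thesis
    by (simp add: vec_eq_iff forall_3 f0_def axis_def)
qed

lemma f0_eigenvalue:
  assumes "U_mult \<epsilon> f0 w = c *\<^sub>R w" "w \<noteq> 0"
  shows "c = 1 \<or> c = 1/2 - \<epsilon> \<or> c = 1/2 + \<epsilon>"
  using assms by (auto simp: vec_eq_iff forall_3 U_mult_components f0_def axis_def)

theorem corollary5p2:
  fixes \<epsilon> \<epsilon>' :: real
  assumes "\<epsilon> \<in> {0..}" and "\<epsilon>' \<in> {0..}" and "\<epsilon> \<noteq> \<epsilon>'"
  shows "\<not> algebra_isomorphic (U_mult \<epsilon>) (U_mult \<epsilon>')"
proof
  assume "algebra_isomorphic (U_mult \<epsilon>) (U_mult \<epsilon>')"
  then obtain \<phi> where \<phi>: "linear \<phi>" "bij \<phi>"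
      and mult: "\<And>x y. \<phi> (U_mult \<epsilon> x y) = U_mult \<epsilon>' (\<phi> x) (\<phi> y)"
    unfolding algebra_isomorphic_def by blast
  have "\<phi> f0 $ 1 = 1"
    using isomorphism_preserves_f0_coordinate[OF \<phi> mult] by (simp add: f0_def axis_def)
  moreover have "U_mult \<epsilon>' (\<phi> f0) (\<phi> f0) = \<phi> f0"
    by (simp add: U_mult_basis flip: mult)
  ultimately have fix_f0: "\<phi> f0 = f0"
    by (intro idempotent_eq_f0)
  have spectrum: "c = 1 \<or> c = 1/2 - \<epsilon>' \<or> c = 1/2 + \<epsilon>'"
    if "U_mult \<epsilon> f0 v = c *\<^sub>R v" "v \<noteq> 0" for c v
  proof (rule f0_eigenvalue)
    show "U_mult \<epsilon>' f0 (\<phi> v) = c *\<^sub>R \<phi> v"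
      using mult[of f0 v] that(1) \<phi>(1) by (simp add: fix_f0 linear_cmul)
    show "\<phi> v \<noteq> 0"
      using that(2) \<phi> by (metis bij_is_inj injD linear_0)
  qed
  have "f1 \<noteq> 0" "f2 \<noteq> 0"
    by (simp_all add: f1_def f2_def)
  with spectrum[of f1] spectrum[of f2]
  have "1/2 - \<epsilon> = 1 \<or> 1/2 - \<epsilon> = 1/2 - \<epsilon>' \<or> 1/2 - \<epsilon> = 1/2 + \<epsilon>'"
    and "1/2 + \<epsilon> = 1 \<or> 1/2 + \<epsilon> = 1/2 - \<epsilon>' \<or> 1/2 + \<epsilon> = 1/2 + \<epsilon>'"
    by (simp_all add: U_mult_basis)
  \<comment> \<open>The second disjunction alone leaves open \<open>\<epsilon> = 1/2\<close>, where \<open>1/2 + \<epsilon>\<close> coincides with the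
    eigenvalue \<open>1\<close>; the first one settles that case.\<close>
  with assms show False by auto
qed

end
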